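(* Let $n\in\mathbb{N}$. The single-quadrant ADRT $R^n$, restricted to the space $\mathcal{F}^n_0$ of square images, is a bijection $R^n:\mathcal{F}^n_0\to\mathcal{F}^n_R$, where $$\mathcal{F}^n_R=\left\{\, g\in\mathcal{G}^n \;\middle|\; P^n_m\circ T^n_m[g]=0,\ m=2,\dots,n \,\right\}.$$
   Context: $\mathbb{N}=\{0,1,2,\dots\}$; $I_k:=\{i\in\mathbb{N}: i<k\}$; $a\,\%\,b$ is the remainder of $a$ modulo $b$. Images: $\mathcal{F}^n:=\{f:\mathbb{Z}\times I_{2^n}\to\mathbb{R}\}$; $\mathcal{F}^n_+:=\{f\in\mathcal{F}^n:$ there is $b_f\in\mathbb{Z}$ with $f(i,\cdot)\equiv 0$ for all $i\le b_f\}$; $\mathcal{F}^n_0:=\{f\in\mathcal{F}^n: \operatorname{supp} f\subset I_{2^n}\times I_{2^n}\}$. $\delta^n_{i,j}\in\mathcal{F}^n$ equals $1$ at $(i,j)$ and $0$ elsewhere. For $f\in\mathcal{F}^n$, $0\le m\le n$, $\ell\in I_{2^{n-m}}$, the section $f^n_{m,\ell}\in\mathcal{F}^m$ is $f^n_{m,\ell}(i,j):=f(i,j+\ell 2^m)$. ADRT: digital lines $D^n_{m,\ell}\langle h,s\rangle\subset\mathbb{Z}\times I_{2^n}$, for $0\le m\le n$, $\ell\in I_{2^{n-m}}$, $(h,s)\in\mathbb{Z}\times I_{2^m}$, are defined by $D^n_{0,\ell}\langle h,0\rangle:=\{(h,\ell)\}$ and, for $m\ge1$, $t\in I_{2^{m-1}}$,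 $$D^n_{m,\ell}\langle h,2t\rangle:=D^n_{m-1,2\ell}\langle h,t\rangle\cup D^n_{m-1,2\ell+1}\langle h+t,t\rangle,$$ $$D^n_{m,\ell}\langle h,2t+1\rangle:=D^n_{m-1,2\ell}\langle h,t\rangle\cup D^n_{m-1,2\ell+1}\langle h+t+1,t\rangle.$$ The single-quadrant ADRT is $R^n:\mathcal{F}^n\to\mathcal{F}^n$, $R^n[f](h,s):=\sum_{(i,j)\in D^n_{n,0}\langle h,s\rangle}f(i,j)$. Partial inverses: for $m\ge 1$, $S_m^{-1}:\mathcal{F}^m_+\to\mathcal{F}^{m-1}_+\times\mathcal{F}^{m-1}_+$ is $S_m^{-1}[g]=[g_0,g_1]$ with $$g_0(h,s)=\sum_{k=-\infty}^{h-1}[g(k+1,2s)-g(k,2s+1)],\qquad g_1(h,s)=\sum_{k=-\infty}^{h-1}[g(k-s,2s+1)-g(k-s,2s)]$$ (each sum has finitely many nonzero terms). For $1\le m\le n$, $(S^n_m)^{-1}:\mathcal{F}^n_+\to\mathcal{F}^n_+$ is $(S^n_m)^{-1}[g]:=f$, where $[f^n_{m-1,2\ell},f^n_{m-1,2\ell+1}]=S_m^{-1}[g^n_{m,\ell}]$ for all $\ell\in I_{2^{n-m}}$. Put $T^n_n:=\mathrm{Id}$ and $T^n_m:=(S^n_{m+1})^{-1}\circ\cdots\circ(S^n_n)^{-1}$ for $m=2,\dots,n-1$. Supports: $E^n_{m,\ell}:=\{(h,s)\in\mathbb{Z}\times I_{2^n}: -(s\,\%\,2^m)\le h\le 2^n-1,\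 s-\ell2^m\in I_{2^m}\}$ for $m=1,\dots,n$, $E^n_{0,\ell}:=I_{2^n}\times\{\ell\}$, and $E^n_m:=\bigcup_{\ell\in I_{2^{n-m}}}E^n_{m,\ell}$. $\mathcal{G}^n_{m,\ell}:=\{f\in\mathcal{F}^n:\operatorname{supp}f\subset E^n_{m,\ell}\}$, $\mathcal{G}^n_m:=\{f\in\mathcal{F}^n:\operatorname{supp}f\subset E^n_m\}=\bigoplus_{\ell}\mathcal{G}^n_{m,\ell}$, and $\mathcal{G}^n:=\mathcal{G}^n_n$. Basis images: for $1\le m\le n$, $\ell\in I_{2^{n-m}}$, $q\in I_{2^{m-1}}$, $p\in\mathbb{Z}$, let $$\phi^n_{m,\ell,p,q}:=\delta^n_{p,2q+\ell2^m}+\delta^n_{p,2q+1+\ell2^m},\qquad \psi^n_{m,\ell,p,q}:=\delta^n_{p,2q+\ell2^m}+\delta^n_{p-1,2q+1+\ell2^m},$$ $$\mu^n_{m,\ell,q}:=\sum_{p=-2q}^{2^n-1}\delta^n_{p,2q+\ell2^m}-\sum_{p=-2q-1}^{2^n-1}\delta^n_{p,2q+1+\ell2^m}.$$ Let $X^n_m$ be the set of all $\phi^n_{m,\ell,p,q}$ with $-q\le p\le 2^n-1$ and all $\psi^n_{m,\ell,p,q}$ with $-2q\le p\le 2^n-q-1$ (over all $\ell\in I_{2^{n-m}}$, $q\in I_{2^{m-1}}$). Let $Y^n_m$ be the set of all $\phi^n_{m,\ell,p,q}$ with $-2q\le p\le -q-1$, all $\psi^n_{m,\ell,p,q}$ with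 $2^n-q\le p\le 2^n-1$, and all $\mu^n_{m,\ell,q}$ (over all $\ell\in I_{2^{n-m}}$, $q\in I_{2^{m-1}}$). One has $\mathcal{G}^n_m=\operatorname{span}X^n_m\oplus\operatorname{span}Y^n_m$, and $P^n_m$ denotes the projection onto $\operatorname{span}Y^n_m$ associated with this direct sum (along $\operatorname{span}X^n_m$). The condition $P^n_m\circ T^n_m[g]=0$ is understood to include $T^n_m[g]\in\mathcal{G}^n_m$ (for $g\in\mathcal{G}^n$ satisfying the conditions with indices $m+1,\dots,n$, this holds automatically).
   Formalization: The conditions defining F^n_R are imposed for m=1,…,n (with T^n_1 given by the same formula) instead of m=2,…,n; as printed the claim fails for every n≥1: for n=1, F^1_R would be G^1, of dimension 5, while F^1_0 has dimension 4. *)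

theory Defs
  imports "HOL-Analysis.Analysis" "HOL-Library.Function_Algebras"
begin

instantiation "fun" :: (type, scaleR) scaleR
begin

definition scaleR_fun :: "real \<Rightarrow> ('a \<Rightarrow> 'b) \<Rightarrow> 'a \<Rightarrow> 'b"
  where "scaleR_fun c f = (\<lambda>x. c *\<^sub>R f x)"

instance ..

end

instance "fun" :: (type, real_vector) real_vector
  by standard (auto simp: scaleR_fun_def plus_fun_def scaleR_add_right scaleR_add_left)

(* An image on Z x I_(2^n) is a function on int x nat that vanishes at every point whose
   second coordinate is outside I_(2^n).  The domain thus fixes the function, and images
   of all sizes live in one real vector space. *)

type_synonym image = "int \<times> nat \<Rightarrow> real"

definition supp :: "image \<Rightarrow> (int \<times> nat) set"
  where "supp f = {x. f x \<noteq> 0}"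

definition images :: "nat \<Rightarrow> image set"
  where "images n = {f. \<forall>h s. s \<ge> 2 ^ n \<longrightarrow> f (h, s) = 0}"

definition images_plus :: "nat \<Rightarrow> image set"
  where "images_plus n = {f \<in> images n. \<exists>b. \<forall>i \<le> b. \<forall>j. f (i, j) = 0}"

definition square_images :: "nat \<Rightarrow> image set"
  where "square_images n = {f \<in> images n. supp f \<subseteq> {0..<2 ^ n} \<times> {..<2 ^ n}}"

definition delta :: "int \<Rightarrow> nat \<Rightarrow> image"
  where "delta i j = (\<lambda>x. if x = (i, j) then 1 else 0)"

definition section_of :: "nat \<Rightarrow> nat \<Rightarrow> image \<Rightarrow> image"
  where "section_of m l f = (\<lambda>(i, j). if j < 2 ^ m then f (i, j + l * 2 ^ m) else 0)"

(* The sets D^n_(m,l)<h,s> do not depend on n, which only bounds m and l. *)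

fun dline :: "nat \<Rightarrow> nat \<Rightarrow> int \<Rightarrow> nat \<Rightarrow> (int \<times> nat) set" where
  "dline 0 l h s = {(h, l)}"
| "dline (Suc m) l h s =
     (let t = s div 2 in
      dline m (2 * l) h t \<union>
      dline m (2 * l + 1) (if even s then h + int t else h + int t + 1) t)"

definition adrt :: "nat \<Rightarrow> image \<Rightarrow> image"
  where "adrt n f = (\<lambda>(h, s). if s < 2 ^ n then \<Sum>x\<in>dline n 0 h s. f x else 0)"

(* For g in images_plus m only finitely many terms of each sum are nonzero. *)

definition partial_inv :: "image \<Rightarrow> image \<times> image"
  where "partial_inv g =
    ((\<lambda>(h, s). \<Sum>\<^sub>\<infinity>k\<in>{..h - 1}. g (k + 1, 2 * s) - g (k, 2 * s + 1)),
     (\<lambda>(h, s). \<Sum>\<^sub>\<infinity>k\<in>{..h - 1}. g (k - int s, 2 * s + 1) - g (k - int s, 2 * s)))"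

(* The image whose sections of level m - 1 with indices 2l and 2l + 1 are the two components
   of partial_inv applied to the section of g of level m with index l; see the lemma below. *)

definition Sinv :: "nat \<Rightarrow> nat \<Rightarrow> image \<Rightarrow> image"
  where "Sinv n m g = (\<lambda>(h, s).
    if s < 2 ^ n then
      let k = s div 2 ^ (m - 1); t = s mod 2 ^ (m - 1);
          g01 = partial_inv (section_of m (k div 2) g)
      in (if even k then fst g01 else snd g01) (h, t)
    else 0)"

lemma sections_Sinv:
  assumes "1 \<le> m" "m \<le> n" "l < 2 ^ (n - m)"
  shows "(section_of (m - 1) (2 * l) (Sinv n m g), section_of (m - 1) (2 * l + 1) (Sinv n m g))
    = partial_inv (section_of m l g)"
proof -
  obtain r where m: "m = Suc r" using assms(1) by (cases m) auto
  have pow: "(2::nat) ^ n = 2 ^ (n - m) * (2 * 2 ^ r)"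
    using assms m by (metis le_add_diff_inverse2 power_Suc power_add)
  have "(l + 1) * (2 * 2 ^ r) \<le> (2::nat) ^ n"
    unfolding pow using assms(3) by (intro mult_right_mono) auto
  then have bound: "j + (2 * l) * 2 ^ r < 2 ^ n" "j + (2 * l + 1) * 2 ^ r < 2 ^ n"
    if "j < 2 ^ r" for j :: nat using that by (auto simp: algebra_simps)
  have out: "fst (partial_inv (section_of m l g)) (h, j) = 0"
      "snd (partial_inv (section_of m l g)) (h, j) = 0"
    if "\<not> j < 2 ^ r" for h j
    using that by (auto simp: partial_inv_def section_of_def m)
  have dm: "(j + k * 2 ^ r) div 2 ^ r = k" "(j + k * 2 ^ r) mod 2 ^ r = j"
    if "j < 2 ^ r" for j k :: nat
    using that by simp_all
  note d0 = dm[of _ "2 * l"] and d1 = dm[of _ "2 * l + 1"]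
  have e0: "section_of r (2 * l) (Sinv n m g) (h, j) = fst (partial_inv (section_of m l g)) (h, j)"
    for h j
    using out[of j h] bound(1)[of j] d0[of j]
    by (cases "j < 2 ^ r") (simp_all add: section_of_def[of r] Sinv_def m Let_def)
  have e1: "section_of r (2 * l + 1) (Sinv n m g) (h, j) = snd (partial_inv (section_of m l g)) (h, j)"
    for h j
  proof (cases "j < 2 ^ r")
    case True
    have "(2 * l + 1) div 2 = l" "odd (2 * l + 1)" by simp_all
    with True bound(2)[OF True] d1[OF True] show ?thesis
      by (simp only: section_of_def[of r] Sinv_def Let_def prod.case if_True if_False m diff_Suc_1)
  qed (use out[of j h] in \<open>simp add: section_of_def[of r]\<close>)
  show ?thesis
    by (rule prod_eqI; rule ext) (use e0 e1 in \<open>simp_all add: m split_paired_all\<close>)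
qed

(* T^n_m = (S^n_(m+1))^(-1) o ... o (S^n_n)^(-1), the identity for m = n. *)

definition Tmap :: "nat \<Rightarrow> nat \<Rightarrow> image \<Rightarrow> image"
  where "Tmap n m = foldr (Sinv n) [Suc m..<Suc n]"

definition Eset :: "nat \<Rightarrow> nat \<Rightarrow> nat \<Rightarrow> (int \<times> nat) set"
  where "Eset n m l =
    (if m = 0 then {0..<2 ^ n} \<times> {l}
     else {(h, s). s < 2 ^ n \<and> - int (s mod 2 ^ m) \<le> h \<and> h \<le> 2 ^ n - 1 \<and>
                   int s - int l * 2 ^ m \<in> {0..<2 ^ m}})"

definition Gspace :: "nat \<Rightarrow> nat \<Rightarrow> image set"
  where "Gspace n m = {f \<in> images n. supp f \<subseteq> (\<Union>l<2 ^ (n - m). Eset n m l)}"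

definition phi :: "nat \<Rightarrow> nat \<Rightarrow> int \<Rightarrow> nat \<Rightarrow> image"
  where "phi m l p q = delta p (2 * q + l * 2 ^ m) + delta p (2 * q + 1 + l * 2 ^ m)"

definition psi :: "nat \<Rightarrow> nat \<Rightarrow> int \<Rightarrow> nat \<Rightarrow> image"
  where "psi m l p q = delta p (2 * q + l * 2 ^ m) + delta (p - 1) (2 * q + 1 + l * 2 ^ m)"

definition mu :: "nat \<Rightarrow> nat \<Rightarrow> nat \<Rightarrow> nat \<Rightarrow> image"
  where "mu n m l q =
    (\<Sum>p\<in>{- 2 * int q..2 ^ n - 1}. delta p (2 * q + l * 2 ^ m)) -
    (\<Sum>p\<in>{- 2 * int q - 1..2 ^ n - 1}. delta p (2 * q + 1 + l * 2 ^ m))"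

definition Xset :: "nat \<Rightarrow> nat \<Rightarrow> image set"
  where "Xset n m =
    {phi m l p q | l p q. l < 2 ^ (n - m) \<and> q < 2 ^ (m - 1) \<and> - int q \<le> p \<and> p \<le> 2 ^ n - 1} \<union>
    {psi m l p q | l p q. l < 2 ^ (n - m) \<and> q < 2 ^ (m - 1) \<and>
                          - 2 * int q \<le> p \<and> p \<le> 2 ^ n - int q - 1}"

definition Yset :: "nat \<Rightarrow> nat \<Rightarrow> image set"
  where "Yset n m =
    {phi m l p q | l p q. l < 2 ^ (n - m) \<and> q < 2 ^ (m - 1) \<and>
                          - 2 * int q \<le> p \<and> p \<le> - int q - 1} \<union>
    {psi m l p q | l p q. l < 2 ^ (n - m) \<and> q < 2 ^ (m - 1) \<and>
                          2 ^ n - int q \<le> p \<and> p \<le> 2 ^ n - 1} \<union>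
    {mu n m l q | l q. l < 2 ^ (n - m) \<and> q < 2 ^ (m - 1)}"

(* The projection onto A along B, for subspaces with A \<inter> B = {0}; meaningful on A + B only. *)

definition projection_along :: "'a::real_vector set \<Rightarrow> 'a set \<Rightarrow> 'a \<Rightarrow> 'a"
  where "projection_along A B g = (THE y. y \<in> A \<and> g - y \<in> B)"

(* Gspace n m is the direct sum of span (Xset n m) and span (Yset n m) for 1 \<le> m \<le> n. *)

definition Pmap :: "nat \<Rightarrow> nat \<Rightarrow> image \<Rightarrow> image"
  where "Pmap n m = projection_along (span (Yset n m)) (span (Xset n m))"

(* Pmap n m is a map on Gspace n m, hence the explicit membership.  The index m has to start
   at 1.  Without the condition for m = 1 the set is too large for every n \<ge> 1: for n = 1 it
   would be all of Gspace 1 1, which has dimension 5, while square_images 1 has dimension 4. *)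

definition adrt_range :: "nat \<Rightarrow> image set"
  where "adrt_range n =
    {g \<in> Gspace n n. \<forall>m\<in>{1..n}. Tmap n m g \<in> Gspace n m \<and> Pmap n m (Tmap n m g) = 0}"

end

theory Submission
  imports Defs
begin

text \<open>
  The transform is the composition of the butterfly steps \<open>S\<^sub>1, \<dots>, S\<^sub>n\<close>, where \<open>S\<^sub>m\<close> combines
  the two halves of each section of level \<open>m\<close>. It sends the delta images that span \<open>G\<^sub>m\<^sub>-\<^sub>1\<close> to
  the functions \<open>\<phi>\<close> and \<open>\<psi>\<close> in \<open>X\<^sub>m\<close>, so \<open>S\<^sub>m\<close> maps \<open>G\<^sub>m\<^sub>-\<^sub>1\<close> onto \<open>span X\<^sub>m\<close>, and the
  partial inverse undoes it by a telescoping sum. Hence a member of \<open>G\<^sub>n\<close> lies in the range if and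
  only if each of its successive partial inverses lies in \<open>span X\<^sub>m\<close>. This is what the
  projection condition says, once \<open>G\<^sub>m = span X\<^sub>m \<oplus> span Y\<^sub>m\<close> is known.

  For the direct sum, fix a pair of neighbouring rows \<open>2r, 2r + 1\<close>. The pixels of its support form a
  path whose edges are the functions \<open>\<phi>\<close> and \<open>\<psi>\<close>. These span the functions with equal row sums,
  and \<open>\<mu>\<close>, whose row sums differ, spans a complement.
\<close>

text \<open>
  A pair of rows \<open>2r, 2r + 1\<close> with \<open>r = q + l * 2 ^ k\<close>, \<open>q < 2 ^ k\<close>, belongs to section \<open>l\<close> of level
  \<open>k + 1\<close>. It is computed from row \<open>q\<close> of the sections \<open>2l\<close> and \<open>2l + 1\<close> of level \<open>k\<close>.
\<close>

definition top_row :: "nat \<Rightarrow> nat \<Rightarrow> nat"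
  where "top_row k r = r mod 2 ^ k + (2 * (r div 2 ^ k)) * 2 ^ k"

definition bot_row :: "nat \<Rightarrow> nat \<Rightarrow> nat"
  where "bot_row k r = r mod 2 ^ k + (2 * (r div 2 ^ k) + 1) * 2 ^ k"

text \<open>The index \<open>k\<close> is the level before the step, so this is the forward
  counterpart of \<open>Sinv n (Suc k)\<close>, acting on all sections at once.\<close>

definition adrt_step :: "nat \<Rightarrow> nat \<Rightarrow> image \<Rightarrow> image"
  where "adrt_step n k f = (\<lambda>(h, s).
    if s < 2 ^ n
    then f (h, top_row k (s div 2)) + f (h + int (s div 2 mod 2 ^ k) + int (s mod 2), bot_row k (s div 2))
    else 0)"

primrec adrt_upto :: "nat \<Rightarrow> nat \<Rightarrow> image \<Rightarrow> image"
  where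
    "adrt_upto n 0 f = f"
  | "adrt_upto n (Suc k) f = adrt_step n k (adrt_upto n k f)"

section \<open>Indexing of rows and row pairs\<close>

lemma top_row_mod [simp]: "top_row k r mod 2 ^ k = r mod 2 ^ k"
  and top_row_div [simp]: "top_row k r div 2 ^ k = 2 * (r div 2 ^ k)"
  by (simp_all add: top_row_def)

lemma bot_row_mod [simp]: "bot_row k r mod 2 ^ k = r mod 2 ^ k"
  and bot_row_div [simp]: "bot_row k r div 2 ^ k = Suc (2 * (r div 2 ^ k))"
  by (simp_all add: bot_row_def del: mult_Suc)

lemma less_pow_iff_div:
  fixes x :: nat
  assumes "k \<le> n"
  shows "x < 2 ^ n \<longleftrightarrow> x div 2 ^ k < 2 ^ (n - k)"
  using assms by (simp add: div_less_iff_less_mult power_add [symmetric])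

lemma pow_diff_Suc:
  assumes "k < n" shows "(2::nat) ^ (n - k) = 2 * 2 ^ (n - Suc k)"
  using assms by (metis Suc_diff_Suc power_Suc)

text \<open>As \<open>2 ^ n\<close> is even, the rows of a pair are both inside the image or both
  outside. This turns the bound on the section index in \<open>Xset\<close> and \<open>Yset\<close>
  into a bound on rows.\<close>

lemma row_pair_less:
  fixes r :: nat
  assumes "k < n"
  shows "2 * r < 2 ^ n \<longleftrightarrow> r div 2 ^ k < 2 ^ (n - Suc k)"
    and "Suc (2 * r) < 2 ^ n \<longleftrightarrow> r div 2 ^ k < 2 ^ (n - Suc k)"
proof -
  obtain d where n: "n = Suc (k + d)" using assms less_iff_Suc_add by blast
  show "2 * r < 2 ^ n \<longleftrightarrow> r div 2 ^ k < 2 ^ (n - Suc k)"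
    by (simp add: n div_less_iff_less_mult power_add mult.commute)
  moreover have "Suc (2 * r) < 2 ^ n \<longleftrightarrow> 2 * r < 2 ^ n"
    unfolding n power_Suc by presburger
  ultimately show "Suc (2 * r) < 2 ^ n \<longleftrightarrow> r div 2 ^ k < 2 ^ (n - Suc k)" by simp
qed

lemma top_row_less:
  assumes "k < n" shows "top_row k r < 2 ^ n \<longleftrightarrow> 2 * r < 2 ^ n"
proof -
  note pow_diff_Suc[OF assms]
  then show ?thesis
    unfolding row_pair_less(1)[OF assms] using assms by (simp add: less_pow_iff_div[of k n])
qed

lemma bot_row_less:
  assumes "k < n" shows "bot_row k r < 2 ^ n \<longleftrightarrow> 2 * r < 2 ^ n"
proof -
  note pow_diff_Suc[OF assms]
  moreover have "Suc (2 * x) < 2 * y \<longleftrightarrow> x < y" for x y :: nat by presburger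
  ultimately show ?thesis
    unfolding row_pair_less(1)[OF assms] using assms by (simp add: less_pow_iff_div[of k n])
qed

lemma row_index [simp]:
  fixes q l :: nat
  assumes "q < 2 ^ k"
  shows "(q + l * 2 ^ k) mod 2 ^ k = q" "(q + l * 2 ^ k) div 2 ^ k = l"
  using assms by simp_all

text \<open>The parity of the section index \<open>s div 2 ^ k\<close> decides: top rows lie in even
  sections, bottom rows in odd ones.\<close>

lemma row_cases:
  obtains (top) r where "s = top_row k r" | (bot) r where "s = bot_row k r"
proof -
  define r where "r = s mod 2 ^ k + (s div 2 ^ k div 2) * 2 ^ k"
  have *: "r mod 2 ^ k = s mod 2 ^ k" "r div 2 ^ k = s div 2 ^ k div 2"
    by (simp_all add: r_def)
  have s: "s = s mod 2 ^ k + (s div 2 ^ k) * 2 ^ k" by (rule mod_div_mult_eq [symmetric])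
  show thesis
  proof (cases "even (s div 2 ^ k)")
    case True
    then have "2 * (s div 2 ^ k div 2) = s div 2 ^ k" by simp
    then have "s = top_row k r" unfolding top_row_def * using s by presburger
    then show thesis by (rule top)
  next
    case False
    then have "2 * (s div 2 ^ k div 2) + 1 = s div 2 ^ k" by simp
    then have "s = bot_row k r" unfolding bot_row_def * using s by presburger
    then show thesis by (rule bot)
  qed
qed

lemma row_inj:
  "top_row k r = top_row k r' \<longleftrightarrow> r = r'"
  "bot_row k r = bot_row k r' \<longleftrightarrow> r = r'"
  "top_row k r \<noteq> bot_row k r'" "bot_row k r \<noteq> top_row k r'"
proof -
  have "r = r'" if "r mod 2 ^ k = r' mod 2 ^ k" "r div 2 ^ k = r' div 2 ^ k"
    using that by (metis div_mult_mod_eq)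
  then show "top_row k r = top_row k r' \<longleftrightarrow> r = r'" "bot_row k r = bot_row k r' \<longleftrightarrow> r = r'"
    by (metis top_row_mod top_row_div mult_cancel1 zero_neq_numeral)
      (metis \<open>_ \<Longrightarrow> _ \<Longrightarrow> r = r'\<close> bot_row_mod bot_row_div mult_cancel1 zero_neq_numeral Suc_inject)
  have "Suc (2 * x) \<noteq> 2 * y" for x y :: nat by presburger
  then show "top_row k r \<noteq> bot_row k r'" "bot_row k r \<noteq> top_row k r'"
    by (metis top_row_div bot_row_div)+
qed

lemma adrt_step_rows:
  "adrt_step n k f (h, 2 * r) =
    (if 2 * r < 2 ^ n then f (h, top_row k r) + f (h + int (r mod 2 ^ k), bot_row k r) else 0)"
  "adrt_step n k f (h, Suc (2 * r)) =
    (if Suc (2 * r) < 2 ^ n then f (h, top_row k r) + f (h + int (r mod 2 ^ k) + 1, bot_row k r) else 0)"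
  by (simp_all add: adrt_step_def)

lemma image_eq_rowsI:
  fixes f g :: image
  assumes "\<And>h r. f (h, 2 * r) = g (h, 2 * r)" "\<And>h r. f (h, Suc (2 * r)) = g (h, Suc (2 * r))"
  shows "f = g"
proof (rule ext, clarify)
  fix h s
  show "f (h, s) = g (h, s)"
    by (cases s rule: parity_cases) (metis assms dvd_def odd_two_times_div_two_succ Suc_eq_plus1)+
qed

section \<open>The spaces G_m and their supports\<close>

text \<open>A row determines its section as \<open>s div 2 ^ m\<close>, which removes the union over
  \<open>l\<close>. At \<open>m = 0\<close> the lower bound becomes \<open>0\<close>, so the formula
  covers the square images too.\<close>

lemma Gspace_iff:
  assumes "m \<le> n"
  shows "f \<in> Gspace n m \<longleftrightarrow>
    (\<forall>h s. f (h, s) \<noteq> 0 \<longrightarrow> s < 2 ^ n \<and> - int (s mod 2 ^ m) \<le> h \<and> h < 2 ^ n)"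
proof -
  have E: "(h, s) \<in> (\<Union>l<2 ^ (n - m). Eset n m l) \<longleftrightarrow>
    s < 2 ^ n \<and> - int (s mod 2 ^ m) \<le> h \<and> h < 2 ^ n" (is "?L \<longleftrightarrow> ?R") for h s
  proof
    assume ?L then show ?R by (auto simp: Eset_def split: if_splits)
  next
    assume R: ?R
    have "s div 2 ^ m < 2 ^ (n - m)" using R less_pow_iff_div[OF assms] by blast
    moreover have "int s - int (s div 2 ^ m) * 2 ^ m = int (s mod 2 ^ m)"
      by (simp add: zdiv_int zmod_int minus_div_mult_eq_mod)
    then have "(h, s) \<in> Eset n m (s div 2 ^ m)"
      using R by (auto simp: Eset_def simp flip: of_nat_less_iff)
    ultimately show ?L by blast
  qed
  show ?thesis
    unfolding Gspace_def images_def supp_def subset_iff mem_Collect_eq split_paired_All E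
    by (auto simp: not_le) (meson not_le)
qed

lemma square_images_eq_Gspace: "square_images n = Gspace n 0"
  unfolding set_eq_iff Gspace_iff[OF le0] square_images_def images_def supp_def subset_iff
  by simp (metis not_le)

lemma subspace_Gspace:
  assumes "m \<le> n" shows "subspace (Gspace n m)"
proof (rule subspaceI)
  fix f g :: image and c :: real
  assume f: "f \<in> Gspace n m"
  then show "c *\<^sub>R f \<in> Gspace n m"
    by (auto simp: Gspace_iff[OF assms] scaleR_fun_def)
  assume "g \<in> Gspace n m"
  moreover have "f (h, s) \<noteq> 0 \<or> g (h, s) \<noteq> 0" if "(f + g) (h, s) \<noteq> 0" for h s
    using that by auto
  ultimately show "f + g \<in> Gspace n m"
    using f unfolding Gspace_iff[OF assms] by blast
qed (simp add: Gspace_iff[OF assms])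

section \<open>One butterfly step on delta images\<close>

lemma linear_adrt_step: "linear (adrt_step n k)"
  by (rule linearI) (auto simp: adrt_step_def scaleR_fun_def fun_eq_iff algebra_simps)

lemma even_row_decomp: "2 * (r mod 2 ^ k) + r div 2 ^ k * 2 ^ Suc k = 2 * r" for r :: nat
proof -
  have "2 * (r mod 2 ^ k) + r div 2 ^ k * 2 ^ Suc k = 2 * (r mod 2 ^ k + r div 2 ^ k * 2 ^ k)"
    by simp
  then show ?thesis unfolding mod_div_mult_eq .
qed

lemma phi_row: "phi (Suc k) (r div 2 ^ k) p (r mod 2 ^ k) = delta p (2 * r) + delta p (Suc (2 * r))"
  and psi_row: "psi (Suc k) (r div 2 ^ k) p (r mod 2 ^ k) = delta p (2 * r) + delta (p - 1) (Suc (2 * r))"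
  and mu_row: "mu n (Suc k) (r div 2 ^ k) (r mod 2 ^ k) =
    (\<Sum>p\<in>{- 2 * int (r mod 2 ^ k)..2 ^ n - 1}. delta p (2 * r)) -
    (\<Sum>p\<in>{- 2 * int (r mod 2 ^ k) - 1..2 ^ n - 1}. delta p (Suc (2 * r)))"
proof -
  note r = even_row_decomp[of r k]
  then have "2 * (r mod 2 ^ k) + 1 + r div 2 ^ k * 2 ^ Suc k = Suc (2 * r)"
    by linarith
  with r show
    "phi (Suc k) (r div 2 ^ k) p (r mod 2 ^ k) = delta p (2 * r) + delta p (Suc (2 * r))"
    "psi (Suc k) (r div 2 ^ k) p (r mod 2 ^ k) = delta p (2 * r) + delta (p - 1) (Suc (2 * r))"
    "mu n (Suc k) (r div 2 ^ k) (r mod 2 ^ k) =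
      (\<Sum>p\<in>{- 2 * int (r mod 2 ^ k)..2 ^ n - 1}. delta p (2 * r)) -
      (\<Sum>p\<in>{- 2 * int (r mod 2 ^ k) - 1..2 ^ n - 1}. delta p (Suc (2 * r)))"
    unfolding phi_def psi_def mu_def by simp_all
qed

text \<open>A pixel of a top row feeds both rows of its pair at its own \<open>h\<close>, which
  gives a \<open>phi\<close>. For a bottom row, \<open>h\<close> drops by
  \<open>q = r mod 2 ^ k\<close> and by \<open>q + 1\<close>, which gives a \<open>psi\<close> with
  \<open>p = h - q\<close>.\<close>

lemma adrt_step_delta:
  assumes "k < n" "2 * r < 2 ^ n"
  shows adrt_step_delta_top:
      "adrt_step n k (delta h (top_row k r)) = delta h (2 * r) + delta h (Suc (2 * r))"
    and adrt_step_delta_bot: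
      "adrt_step n k (delta h (bot_row k r)) =
        delta (h - int (r mod 2 ^ k)) (2 * r) + delta (h - int (r mod 2 ^ k) - 1) (Suc (2 * r))"
proof -
  have n: "Suc (2 * r) < 2 ^ n" using row_pair_less assms by simp
  have ne: "2 * x \<noteq> Suc (2 * y)" "Suc (2 * y) \<noteq> 2 * x" for x y :: nat by presburger+
  show "adrt_step n k (delta h (top_row k r)) = delta h (2 * r) + delta h (Suc (2 * r))"
    by (rule image_eq_rowsI) (use assms(2) n in \<open>auto simp: ne adrt_step_rows delta_def row_inj\<close>)
  show "adrt_step n k (delta h (bot_row k r)) =
      delta (h - int (r mod 2 ^ k)) (2 * r) + delta (h - int (r mod 2 ^ k) - 1) (Suc (2 * r))"
    by (rule image_eq_rowsI) (use assms(2) n in \<open>auto simp: ne adrt_step_rows delta_def row_inj\<close>)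
qed

text \<open>The change of variables \<open>r = q + l * 2 ^ k\<close>, with the basis image
  \<open>F\<close> and the range \<open>P\<close> kept abstract so that it serves every family in
  \<open>Xset\<close> and \<open>Yset\<close>.\<close>

lemma ex_row_index:
  fixes k n :: nat and P :: "int \<Rightarrow> nat \<Rightarrow> bool"
  assumes "k < n"
  shows "(\<exists>l p q. v = F l p q \<and> l < 2 ^ (n - Suc k) \<and> q < 2 ^ (Suc k - 1) \<and> P p q) \<longleftrightarrow>
    (\<exists>p r. v = F (r div 2 ^ k) p (r mod 2 ^ k) \<and> 2 * r < 2 ^ n \<and> P p (r mod 2 ^ k))"
    (is "?L \<longleftrightarrow> ?R")
proof
  assume ?L
  then obtain l p q where *: "v = F l p q" "l < 2 ^ (n - Suc k)" "q < 2 ^ k" "P p q"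
    by auto
  then show ?R
    unfolding row_pair_less(1)[OF assms] by (intro exI[of _ p] exI[of _ "q + l * 2 ^ k"]) simp
next
  assume ?R
  then obtain p r where "v = F (r div 2 ^ k) p (r mod 2 ^ k)" "2 * r < 2 ^ n" "P p (r mod 2 ^ k)"
    by blast
  then show ?L
    unfolding row_pair_less(1)[OF assms]
    by (intro exI[of _ p] exI[of _ "r div 2 ^ k"] exI[of _ "r mod 2 ^ k"]) simp
qed

lemma Xset_rows:
  assumes "k < n"
  shows "Xset n (Suc k) =
    {delta p (2 * r) + delta p (Suc (2 * r)) | p r.
      2 * r < 2 ^ n \<and> - int (r mod 2 ^ k) \<le> p \<and> p \<le> 2 ^ n - 1} \<union>
    {delta p (2 * r) + delta (p - 1) (Suc (2 * r)) | p r.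
      2 * r < 2 ^ n \<and> - 2 * int (r mod 2 ^ k) \<le> p \<and> p \<le> 2 ^ n - int (r mod 2 ^ k) - 1}"
  unfolding Xset_def phi_row [symmetric, of _ _ k] psi_row [symmetric, of _ _ k]
    ex_row_index[OF assms] ..

lemma Yset_rows:
  assumes "k < n"
  shows "Yset n (Suc k) =
    {delta p (2 * r) + delta p (Suc (2 * r)) | p r.
      2 * r < 2 ^ n \<and> - 2 * int (r mod 2 ^ k) \<le> p \<and> p \<le> - int (r mod 2 ^ k) - 1} \<union>
    {delta p (2 * r) + delta (p - 1) (Suc (2 * r)) | p r.
      2 * r < 2 ^ n \<and> 2 ^ n - int (r mod 2 ^ k) \<le> p \<and> p \<le> 2 ^ n - 1} \<union>
    {(\<Sum>p\<in>{- 2 * int (r mod 2 ^ k)..2 ^ n - 1}. delta p (2 * r)) -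
     (\<Sum>p\<in>{- 2 * int (r mod 2 ^ k) - 1..2 ^ n - 1}. delta p (Suc (2 * r))) | r. 2 * r < 2 ^ n}"
proof -
  have "(\<exists>l q. v = mu n (Suc k) l q \<and> l < 2 ^ (n - Suc k) \<and> q < 2 ^ (Suc k - 1)) \<longleftrightarrow>
      (\<exists>r. v = mu n (Suc k) (r div 2 ^ k) (r mod 2 ^ k) \<and> 2 * r < 2 ^ n)" for v
    using ex_row_index[OF assms, of v "\<lambda>l p q. mu n (Suc k) l q" "\<lambda>_ _. True"] by simp
  then show ?thesis
    unfolding Yset_def phi_row [symmetric, of _ _ k] psi_row [symmetric, of _ _ k]
      mu_row [symmetric, of _ k] ex_row_index[OF assms] by presburger
qed

lemma image_sum_apply:
  fixes F :: "'a \<Rightarrow> image"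
  shows "(\<Sum>x\<in>B. F x) y = (\<Sum>x\<in>B. F x y)"
  by (induction B rule: infinite_finite_induct) auto

lemma image_expansion:
  assumes "finite A" "supp f \<subseteq> A"
  shows "f = (\<Sum>x\<in>A. f x *\<^sub>R delta (fst x) (snd x))"
proof
  fix y
  have "(\<Sum>x\<in>A. f x *\<^sub>R delta (fst x) (snd x) y) = (\<Sum>x\<in>A. if y = x then f x else 0)"
    by (intro sum.cong) (auto simp: delta_def)
  also have "\<dots> = f y" using assms by (auto simp: sum.delta supp_def)
  finally show "f y = (\<Sum>x\<in>A. f x *\<^sub>R delta (fst x) (snd x)) y"
    by (simp add: image_sum_apply scaleR_fun_def)
qed

lemma int_mod_less_pow:
  assumes "s < 2 ^ n" shows "int (s mod m) < 2 ^ n"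
proof -
  have "s mod m < 2 ^ n"
    using assms mod_less_eq_dividend le_less_trans by blast
  then show ?thesis by (simp flip: of_nat_less_iff)
qed

lemma Gspace_eq_span:
  assumes "m \<le> n"
  shows "Gspace n m = span {delta h s | h s. s < 2 ^ n \<and> - int (s mod 2 ^ m) \<le> h \<and> h < 2 ^ n}"
    (is "_ = span ?D")
proof
  show "span ?D \<subseteq> Gspace n m"
    by (rule span_minimal[OF _ subspace_Gspace[OF assms]])
      (auto simp: Gspace_iff[OF assms] delta_def split: if_splits)
next
  \<comment> \<open>The box makes \<open>A\<close> finite, and its lower end
    \<open>- (2 ^ n)\<close> loses nothing because \<open>s mod 2 ^ m < 2 ^ n\<close>.\<close>
  define A where "A = (SIGMA h:{- (2 ^ n)..<2 ^ n}. {s. s < 2 ^ n \<and> - int (s mod 2 ^ m) \<le> h})"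
  have fin: "finite A" unfolding A_def by (intro finite_SigmaI) auto
  show "Gspace n m \<subseteq> span ?D"
  proof
    fix f assume f: "f \<in> Gspace n m"
    then have "supp f \<subseteq> A"
      unfolding supp_def Gspace_iff[OF assms] A_def
      by clarify (smt (verit) int_mod_less_pow atLeastLessThan_iff mem_Collect_eq mem_Sigma_iff)
    from image_expansion[OF fin this]
    have "f = (\<Sum>x\<in>A. f x *\<^sub>R delta (fst x) (snd x))" .
    also have "\<dots> \<in> span ?D"
      by (intro span_sum span_scale span_base) (fastforce simp: A_def)
    finally show "f \<in> span ?D" .
  qed
qed

text \<open>By linearity it suffices to follow the deltas spanning level \<open>k\<close>. With
  \<open>q = r mod 2 ^ k\<close>, their bounds \<open>- q \<le> h < 2 ^ n\<close> become the range
  of \<open>phi\<close> in \<open>Xset\<close> for top rows and, shifted by \<open>q\<close>, that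
  of \<open>psi\<close> for bottom rows.\<close>

lemma adrt_step_image_Gspace:
  assumes "k < n"
  shows "adrt_step n k ` Gspace n k = span (Xset n (Suc k))"
proof -
  let ?D = "{delta h s | h s. s < 2 ^ n \<and> - int (s mod 2 ^ k) \<le> h \<and> h < 2 ^ n}"
  have "?D = {delta h (top_row k r) | h r. 2 * r < 2 ^ n \<and> - int (r mod 2 ^ k) \<le> h \<and> h < 2 ^ n} \<union>
      {delta h (bot_row k r) | h r. 2 * r < 2 ^ n \<and> - int (r mod 2 ^ k) \<le> h \<and> h < 2 ^ n}"
    (is "_ = ?T \<union> ?B")
  proof (intro equalityI subsetI)
    fix v assume "v \<in> ?D"
    then obtain h s where v: "v = delta h s" "s < 2 ^ n" "- int (s mod 2 ^ k) \<le> h" "h < 2 ^ n"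
      by blast
    show "v \<in> ?T \<union> ?B"
      by (cases s rule: row_cases[of _ k])
        (use v top_row_less[OF assms] bot_row_less[OF assms] top_row_mod bot_row_mod in
          \<open>metis (mono_tags, lifting) UnI1 UnI2 mem_Collect_eq\<close>)+
  next
    fix v assume "v \<in> ?T \<union> ?B"
    then show "v \<in> ?D"
      using top_row_less[OF assms] bot_row_less[OF assms] top_row_mod bot_row_mod by fastforce
  qed
  moreover have "adrt_step n k ` ?T = {delta p (2 * r) + delta p (Suc (2 * r)) | p r.
      2 * r < 2 ^ n \<and> - int (r mod 2 ^ k) \<le> p \<and> p \<le> 2 ^ n - 1}"
(is "_ = ?Phi")
  proof (intro equalityI subsetI)
    fix v assume "v \<in> adrt_step n k ` ?T"
    then obtain h r where *: "v = adrt_step n k (delta h (top_row k r))"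
        "2 * r < 2 ^ n" "- int (r mod 2 ^ k) \<le> h" "h < 2 ^ n" by blast
    then show "v \<in> ?Phi"
      unfolding *(1) adrt_step_delta_top[OF assms *(2)] mem_Collect_eq
      by (intro exI[of _ h] exI[of _ r]) simp
  next
    fix v assume "v \<in> ?Phi"
    then obtain p r where *: "v = delta p (2 * r) + delta p (Suc (2 * r))"
        "2 * r < 2 ^ n" "- int (r mod 2 ^ k) \<le> p" "p \<le> 2 ^ n - 1" by blast
    have "delta p (top_row k r) \<in> ?T" using *(2-4) by auto
    moreover have "v = adrt_step n k (delta p (top_row k r))"
      unfolding *(1) adrt_step_delta_top[OF assms *(2)] ..
    ultimately show "v \<in> adrt_step n k ` ?T" by blast
  qed
  moreover have "adrt_step n k ` ?B = {delta p (2 * r) + delta (p - 1) (Suc (2 * r)) | p r.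
      2 * r < 2 ^ n \<and> - 2 * int (r mod 2 ^ k) \<le> p \<and> p \<le> 2 ^ n - int (r mod 2 ^ k) - 1}" (is "_ = ?Psi")
  proof (intro equalityI subsetI)
    fix v assume "v \<in> adrt_step n k ` ?B"
    then obtain h r where *: "v = adrt_step n k (delta h (bot_row k r))"
        "2 * r < 2 ^ n" "- int (r mod 2 ^ k) \<le> h" "h < 2 ^ n" by blast
    then show "v \<in> ?Psi"
      unfolding *(1) adrt_step_delta_bot[OF assms *(2)] mem_Collect_eq
      by (intro exI[of _ "h - int (r mod 2 ^ k)"] exI[of _ r]) simp
  next
    fix v assume "v \<in> ?Psi"
    then obtain p r where *: "v = delta p (2 * r) + delta (p - 1) (Suc (2 * r))"
        "2 * r < 2 ^ n" "- 2 * int (r mod 2 ^ k) \<le> p" "p \<le> 2 ^ n - int (r mod 2 ^ k) - 1" by blast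
    let ?h = "p + int (r mod 2 ^ k)"
    have "- int (r mod 2 ^ k) \<le> ?h \<and> ?h < 2 ^ n" using *(3,4) by simp
    then have "delta ?h (bot_row k r) \<in> ?B" using *(2) by blast
    moreover have "v = adrt_step n k (delta ?h (bot_row k r))"
      unfolding *(1) adrt_step_delta_bot[OF assms *(2)] by simp
    ultimately show "v \<in> adrt_step n k ` ?B" by blast
  qed
  ultimately have "adrt_step n k ` ?D = Xset n (Suc k)"
    unfolding Xset_rows[OF assms] by (simp only: image_Un)
  then show ?thesis
    unfolding Gspace_eq_span[OF less_imp_le[OF assms]]
    using linear_span_image[OF linear_adrt_step, of n k ?D] by (simp only:)
qed

lemma even_row_mod: "2 * r mod 2 ^ Suc k = 2 * (r mod 2 ^ k)"
  and odd_row_mod: "Suc (2 * r) mod 2 ^ Suc k = Suc (2 * (r mod 2 ^ k))" for r :: nat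
  by (simp_all add: mod_mult2_eq mod_Suc)

lemma Xset_subset_Gspace:
  assumes "k < n" shows "span (Xset n (Suc k)) \<subseteq> Gspace n (Suc k)"
proof (rule span_minimal[OF _ subspace_Gspace])
  note m = even_row_mod odd_row_mod
  have "Suc (2 * r) < 2 ^ n" if "2 * r < 2 ^ n" for r :: nat
    using that row_pair_less[OF assms] by simp
  then show "Xset n (Suc k) \<subseteq> Gspace n (Suc k)"
    using assms unfolding Xset_rows[OF assms]
    by (auto simp: Gspace_iff delta_def m simp del: power_Suc split: if_splits)
qed (use assms in simp)

section \<open>The partial inverse undoes a step\<close>

lemma infsum_telescope_int:
  fixes F :: "int \<Rightarrow> real"
  assumes "\<And>j. j \<le> b \<Longrightarrow> F j = 0"
  shows "(\<Sum>\<^sub>\<infinity>j\<in>{..h - 1}. F (j + 1) - F j) = F h"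
proof -
  have "(\<Sum>j\<in>{b..<h}. F (j + 1) - F j) = F h - F b" if "b \<le> h" for h
    using that
  proof (induction h rule: int_ge_induct)
    case (step i)
    then have "{b..<i + 1} = insert i {b..<i}" by auto
    with step show ?case by simp
  qed simp
  then have fin: "(\<Sum>j\<in>{b..<h}. F (j + 1) - F j) = F h"
    using assms by (cases "b \<le> h") auto
  \<comment> \<open>For \<open>j < b\<close> also \<open>j + 1 \<le> b\<close>, so every summand to
    the left of \<open>b\<close> is zero.\<close>
  have "(\<Sum>\<^sub>\<infinity>j\<in>{..h - 1}. F (j + 1) - F j) = (\<Sum>\<^sub>\<infinity>j\<in>{b..<h}. F (j + 1) - F j)"
    by (rule infsum_cong_neutral) (auto simp: assms)
  then show ?thesis using fin by simp
qed

lemma Sinv_rows: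
  assumes "k < n" "2 * r < 2 ^ n"
  shows "Sinv n (Suc k) g (h, top_row k r) =
      (\<Sum>\<^sub>\<infinity>j\<in>{..h - 1}. g (j + 1, 2 * r) - g (j, Suc (2 * r)))"
    and "Sinv n (Suc k) g (h, bot_row k r) =
      (\<Sum>\<^sub>\<infinity>j\<in>{..h - 1}. g (j - int (r mod 2 ^ k), Suc (2 * r)) - g (j - int (r mod 2 ^ k), 2 * r))"
proof -
  note r = even_row_decomp[of r k]
  have q': "2 * (r mod 2 ^ k) < 2 ^ Suc k" "Suc (2 * (r mod 2 ^ k)) < 2 ^ Suc k"
    using odd_row_mod[of r k] mod_less_divisor[of "2 ^ Suc k" "Suc (2 * r)"]
    by simp_all
  have sec: "section_of (Suc k) (r div 2 ^ k) g (i, 2 * (r mod 2 ^ k)) = g (i, 2 * r)"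
      "section_of (Suc k) (r div 2 ^ k) g (i, 2 * (r mod 2 ^ k) + 1) = g (i, Suc (2 * r))" for i
    using q' r by (simp_all add: section_of_def)
  have half: "Suc (2 * x) div 2 = x" for x :: nat by simp
  show "Sinv n (Suc k) g (h, top_row k r) =
      (\<Sum>\<^sub>\<infinity>j\<in>{..h - 1}. g (j + 1, 2 * r) - g (j, Suc (2 * r)))"
    using assms(2) top_row_less[OF assms(1), of r]
    by (simp add: Sinv_def partial_inv_def sec [unfolded Suc_eq_plus1 [symmetric]] Let_def)
  show "Sinv n (Suc k) g (h, bot_row k r) =
      (\<Sum>\<^sub>\<infinity>j\<in>{..h - 1}. g (j - int (r mod 2 ^ k), Suc (2 * r)) - g (j - int (r mod 2 ^ k), 2 * r))"
    using assms(2) bot_row_less[OF assms(1), of r]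
    by (simp add: Sinv_def partial_inv_def sec [unfolded Suc_eq_plus1 [symmetric]] Let_def half)
qed

text \<open>In the sum for a top row the contributions of the bottom row cancel, and conversely.
  What is left telescopes, as \<open>f\<close> vanishes far to the left.\<close>

lemma Sinv_adrt_step:
  assumes "k < n" "f \<in> Gspace n k"
  shows "Sinv n (Suc k) (adrt_step n k f) = f"
proof (rule ext, clarify)
  fix h s
  have z: "f (j, t) = 0" if "j \<le> - (2 ^ n)" for j t
  proof (rule ccontr)
    assume "f (j, t) \<noteq> 0"
    then have "t < 2 ^ n" "- int (t mod 2 ^ k) \<le> j"
      using assms by (auto simp: Gspace_iff)
    then show False using that int_mod_less_pow[of t n "2 ^ k"] by linarith
  qed
  have out: "f (h, s) = 0" if "\<not> s < 2 ^ n"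
    using assms that by (auto simp: Gspace_iff)
  have suc: "Suc (2 * r) < 2 ^ n \<longleftrightarrow> 2 * r < 2 ^ n" for r :: nat
    using row_pair_less[OF assms(1)] by simp
  show "Sinv n (Suc k) (adrt_step n k f) (h, s) = f (h, s)"
  proof (cases "s < 2 ^ n")
    case False
    then show ?thesis using out by (simp add: Sinv_def)
  next
    case True
    show ?thesis
    proof (cases s rule: row_cases[of _ k])
      case (top r)
      then have r: "2 * r < 2 ^ n" using True top_row_less[OF assms(1)] by simp
      have "Sinv n (Suc k) (adrt_step n k f) (h, s) =
          (\<Sum>\<^sub>\<infinity>j\<in>{..h - 1}. f (j + 1, top_row k r) - f (j, top_row k r))"
        unfolding top Sinv_rows[OF assms(1) r] adrt_step_rows using r suc
        by (intro infsum_cong) (simp add: add_ac)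
      also have "\<dots> = f (h, s)"
        unfolding top by (rule infsum_telescope_int[where F = "\<lambda>j. f (j, top_row k r)"]) (rule z)
      finally show ?thesis .
    next
      case (bot r)
      then have r: "2 * r < 2 ^ n" using True bot_row_less[OF assms(1)] by simp
      have "Sinv n (Suc k) (adrt_step n k f) (h, s) =
          (\<Sum>\<^sub>\<infinity>j\<in>{..h - 1}. f (j + 1, bot_row k r) - f (j, bot_row k r))"
        unfolding bot Sinv_rows[OF assms(1) r] adrt_step_rows using r suc
        by (intro infsum_cong) simp
      also have "\<dots> = f (h, s)"
        unfolding bot by (rule infsum_telescope_int[where F = "\<lambda>j. f (j, bot_row k r)"]) (rule z)
      finally show ?thesis .
    qed
  qed
qed

section \<open>Digital lines as iterated steps\<close>

lemma finite_dline [simp]: "finite (dline k l h s)"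
  by (induction k arbitrary: l h s) (simp_all add: Let_def)

text \<open>Used to see that the two halves of a digital line, lying in different sections, are
  disjoint.\<close>

lemma dline_rows: "x \<in> dline k l h s \<Longrightarrow> snd x div 2 ^ k = l"
proof (induction k arbitrary: l h s)
  case (Suc k)
  then have "snd x div 2 ^ k = 2 * l \<or> snd x div 2 ^ k = 2 * l + 1"
    by (auto simp: Let_def)
  then have "snd x div 2 ^ k div 2 = l" by auto
  then show ?case by (simp add: div_mult2_eq [symmetric] mult.commute)
qed simp

text \<open>The recursion joins disjoint lines from sections \<open>2 * l\<close> and
  \<open>2 * l + 1\<close>, whose sums are the two terms of \<open>adrt_step\<close>. The induction
  therefore has to carry all sections.\<close>

lemma sum_dline:
  assumes "k \<le> n" "s < 2 ^ k" "l < 2 ^ (n - k)"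
  shows "(\<Sum>x\<in>dline k l h s. f x) = adrt_upto n k f (h, s + l * 2 ^ k)"
  using assms
proof (induction k arbitrary: l h s)
  case (Suc k)
  define r where "r = s div 2 + l * 2 ^ k"
  have k: "k < n" using Suc.prems by simp
  have t: "s div 2 < 2 ^ k" using Suc.prems by (simp add: div_less_iff_less_mult mult.commute)
  have l: "2 * l < 2 ^ (n - k)" "2 * l + 1 < 2 ^ (n - k)" using Suc.prems unfolding pow_diff_Suc[OF k] by simp_all
  have r: "r mod 2 ^ k = s div 2" "r div 2 ^ k = l" using t by (simp_all add: r_def)
  have s: "(s + l * 2 ^ Suc k) div 2 = r" "(s + l * 2 ^ Suc k) mod 2 = s mod 2"
    by (simp_all add: r_def mod_add_eq [symmetric])
  have le: "s + l * 2 ^ Suc k < 2 ^ n"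
    unfolding less_pow_iff_div[OF Suc.prems(1)] using Suc.prems by simp
  define h' where "h' = (if even s then h + int (s div 2) else h + int (s div 2) + 1)"
  have "dline k (2 * l) h (s div 2) \<inter> dline k (2 * l + 1) h' (s div 2) = {}"
    using dline_rows[of _ k "2 * l"] dline_rows[of _ k "2 * l + 1"] by fastforce
  then have "(\<Sum>x\<in>dline (Suc k) l h s. f x) =
      (\<Sum>x\<in>dline k (2 * l) h (s div 2). f x) + (\<Sum>x\<in>dline k (2 * l + 1) h' (s div 2). f x)"
    by (simp add: Let_def h'_def [symmetric] sum.union_disjoint)
  also have "\<dots> = adrt_upto n k f (h, s div 2 + (2 * l) * 2 ^ k) +
      adrt_upto n k f (h', s div 2 + (2 * l + 1) * 2 ^ k)"
    using Suc.IH[OF less_imp_le[OF k] t] l by simp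
  also have "h' = h + int (s div 2) + int (s mod 2)"
    by (simp add: h'_def mod_2_eq_odd)
  finally show ?case
    using le unfolding adrt_upto.simps adrt_step_def s r top_row_def bot_row_def prod.case
    by (simp only: if_True)
qed simp

lemma adrt_eq_adrt_upto:
  assumes "f \<in> images n" shows "adrt n f = adrt_upto n n f"
proof (rule ext, clarify)
  fix h s
  \<comment> \<open>For \<open>n = 0\<close> no step has cut off the outer rows, so their vanishing
    comes from \<open>f \<in> images n\<close>.\<close>
  have "adrt_upto n n f (h, s) = 0" if "\<not> s < 2 ^ n"
    using assms that by (cases n) (auto simp: images_def adrt_step_def)
  then show "adrt n f (h, s) = adrt_upto n n f (h, s)"
    using sum_dline[of n n s 0 f h] by (simp add: adrt_def)
qed

lemma Tmap_Suc: "k < n \<Longrightarrow> Tmap n k g = Sinv n (Suc k) (Tmap n (Suc k) g)"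
  using upt_conv_Cons[of "Suc k" "Suc n"] by (simp only: Tmap_def Suc_less_eq foldr.simps o_apply)

section \<open>The spans of X and Y meet only in 0\<close>

text \<open>
  Here \<open>a\<close> and \<open>b\<close> are the coefficients of \<open>\<phi>\<close> and \<open>\<psi>\<close>, and \<open>c\<close> is that of \<open>\<mu>\<close>, on one pair of rows.
  The increments of \<open>b\<close> are multiples of \<open>c\<close> by nonnegative numbers that are not all zero, while \<open>b\<close>
  vanishes at both ends.
\<close>

lemma path_coefficients_unique:
  fixes a b :: "int \<Rightarrow> real" and c :: real
  assumes "lo \<le> hi" and b: "\<And>j. \<not> (lo \<le> j \<and> j \<le> hi) \<Longrightarrow> b j = 0"
    and even: "\<And>j. a j + b j + (if lo \<le> j \<and> j \<le> hi then c else 0) = 0"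
    and odd: "\<And>j. a j + b (j + 1) - (if lo - 1 \<le> j \<and> j \<le> hi then c else 0) = 0"
  shows "c = 0" "a j = 0" "b j = 0"
proof -
  have diff: "b (j + 1) - b j =
      c * ((if lo - 1 \<le> j \<and> j \<le> hi then 1 else 0) + (if lo \<le> j \<and> j \<le> hi then 1 else 0))" for j
    using even[of j] odd[of j] by (auto split: if_splits)
  \<comment> \<open>After multiplication by \<open>c\<close> every increment is \<open>c * c\<close>
    times 0, 1 or 2, whatever the sign of \<open>c\<close>. The one from \<open>lo - 1\<close> to
    \<open>lo\<close> already contributes \<open>c * c\<close>.\<close>
  have sgn: "0 \<le> c * b j \<and> (lo \<le> j \<longrightarrow> j \<le> hi + 1 \<longrightarrow> c * c \<le> c * b j)" if "lo - 1 \<le> j" "j \<le> hi + 1" for j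
    using that
  proof (induction j rule: int_ge_induct)
    case base
    then show ?case using b by simp
  next
    case (step i)
    have "c * b (i + 1) = c * b i + c * (b (i + 1) - b i)" by (simp add: algebra_simps)
    then show ?case
      using step diff[of i] by auto
  qed
  from sgn[of "hi + 1"] have "c * c \<le> 0"
    using assms(1) b[of "hi + 1"] by simp
  then show c: "c = 0" by (auto simp: mult_le_0_iff)
  have const: "b (j + 1) = b j" for j using diff[of j] c by simp
  have "b j = 0" for j
  proof (cases "lo - 1 \<le> j")
    case True
    then show ?thesis
      by (induction j rule: int_ge_induct) (use b const in auto)
  qed (use b in simp)
  then show "a j = 0" "b j = 0" using even[of j] c by auto
qed

text \<open>The generators have coefficients of this form, and the form survives linear
  combinations. The argument \<open>p + 1\<close> in the odd row arises because \<open>psi\<close>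
  with index \<open>p\<close> has its second pixel at \<open>p - 1\<close>.\<close>

lemma span_Yset_coefficients:
  assumes "k < n" "v \<in> span (Yset n (Suc k))"
  obtains a b :: "nat \<Rightarrow> int \<Rightarrow> real" and c :: "nat \<Rightarrow> real"
  where
    "\<And>r p. a r p \<noteq> 0 \<Longrightarrow> - 2 * int (r mod 2 ^ k) \<le> p \<and> p \<le> - int (r mod 2 ^ k) - 1"
    "\<And>r p. b r p \<noteq> 0 \<Longrightarrow> 2 ^ n - int (r mod 2 ^ k) \<le> p \<and> p \<le> 2 ^ n - 1"
    "\<And>r p. v (p, 2 * r) =
      a r p + b r p + (if - 2 * int (r mod 2 ^ k) \<le> p \<and> p \<le> 2 ^ n - 1 then c r else 0)"
    "\<And>r p. v (p, Suc (2 * r)) =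
      a r p + b r (p + 1) - (if - 2 * int (r mod 2 ^ k) - 1 \<le> p \<and> p \<le> 2 ^ n - 1 then c r else 0)"
proof -
  define Q where "Q v a b c \<longleftrightarrow>
    (\<forall>r p. (a r p \<noteq> 0 \<longrightarrow> - 2 * int (r mod 2 ^ k) \<le> p \<and> p \<le> - int (r mod 2 ^ k) - 1) \<and>
      (b r p \<noteq> 0 \<longrightarrow> 2 ^ n - int (r mod 2 ^ k) \<le> p \<and> p \<le> 2 ^ n - 1) \<and>
      v (p, 2 * r) =
        a r p + b r p + (if - 2 * int (r mod 2 ^ k) \<le> p \<and> p \<le> 2 ^ n - 1 then c r else 0) \<and>
      v (p, Suc (2 * r)) =
        a r p + b r (p + 1) - (if - 2 * int (r mod 2 ^ k) - 1 \<le> p \<and> p \<le> 2 ^ n - 1 then c r else 0))"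
    for v :: image and a b :: "nat \<Rightarrow> int \<Rightarrow> real" and c :: "nat \<Rightarrow> real"
  have ne: "2 * x \<noteq> Suc (2 * y)" "Suc (2 * y) \<noteq> 2 * x" for x y :: nat by presburger+
  have row: "(\<Sum>p\<in>{lo..hi}. delta p s) (p', s') = (if s' = s \<and> lo \<le> p' \<and> p' \<le> hi then 1 else 0)"
    for lo hi p' and s s' :: nat
    unfolding image_sum_apply by (cases "s' = s") (simp_all add: delta_def)
  have "span (Yset n (Suc k)) \<subseteq> {v. \<exists>a b c. Q v a b c}"
  proof (rule span_minimal)
    show "Yset n (Suc k) \<subseteq> {v. \<exists>a b c. Q v a b c}"
    proof
      fix v assume "v \<in> Yset n (Suc k)"
      then consider
          (phi) p r where "v = delta p (2 * r) + delta p (Suc (2 * r))"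
            "- 2 * int (r mod 2 ^ k) \<le> p" "p \<le> - int (r mod 2 ^ k) - 1"
        | (psi) p r where "v = delta p (2 * r) + delta (p - 1) (Suc (2 * r))"
            "2 ^ n - int (r mod 2 ^ k) \<le> p" "p \<le> 2 ^ n - 1"
        | (mu) r where "v = (\<Sum>p\<in>{- 2 * int (r mod 2 ^ k)..2 ^ n - 1}. delta p (2 * r)) -
            (\<Sum>p\<in>{- 2 * int (r mod 2 ^ k) - 1..2 ^ n - 1}. delta p (Suc (2 * r)))"
        unfolding Yset_rows[OF assms(1)] by blast
      then show "v \<in> {v. \<exists>a b c. Q v a b c}"
      proof cases
        case phi
        then have "Q v (\<lambda>r' p'. if r' = r \<and> p' = p then 1 else 0) (\<lambda>_ _. 0) (\<lambda>_. 0)"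
          by (auto simp: Q_def delta_def ne)
        then show ?thesis by blast
      next
        case psi
        then have "Q v (\<lambda>_ _. 0) (\<lambda>r' p'. if r' = r \<and> p' = p then 1 else 0) (\<lambda>_. 0)"
          by (auto simp: Q_def delta_def ne)
        then show ?thesis by blast
      next
        case mu
        then have "Q v (\<lambda>_ _. 0) (\<lambda>_ _. 0) (\<lambda>r'. if r' = r then 1 else 0)"
          by (auto simp: Q_def row ne)
        then show ?thesis by blast
      qed
    qed
    show "subspace {v. \<exists>a b c. Q v a b c}"
    proof (rule subspaceI)
      show "0 \<in> {v. \<exists>a b c. Q v a b c}"
        by (intro CollectI exI[of _ "\<lambda>_ _. 0"] exI[of _ "\<lambda>_. 0"]) (simp add: Q_def)
    next
      fix v w assume "v \<in> {v. \<exists>a b c. Q v a b c}" "w \<in> {v. \<exists>a b c. Q v a b c}"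
      then obtain a b c a' b' c' where *: "Q v a b c" "Q w a' b' c'" by blast
      have "Q (v + w) (\<lambda>r p. a r p + a' r p) (\<lambda>r p. b r p + b' r p) (\<lambda>r. c r + c' r)"
        unfolding Q_def
      proof (intro allI)
        fix r p
        show "(a r p + a' r p \<noteq> 0 \<longrightarrow> - 2 * int (r mod 2 ^ k) \<le> p \<and> p \<le> - int (r mod 2 ^ k) - 1) \<and>
          (b r p + b' r p \<noteq> 0 \<longrightarrow> 2 ^ n - int (r mod 2 ^ k) \<le> p \<and> p \<le> 2 ^ n - 1) \<and>
          (v + w) (p, 2 * r) = a r p + a' r p + (b r p + b' r p) +
            (if - 2 * int (r mod 2 ^ k) \<le> p \<and> p \<le> 2 ^ n - 1 then c r + c' r else 0) \<and>
          (v + w) (p, Suc (2 * r)) = a r p + a' r p + (b r (p + 1) + b' r (p + 1)) -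
            (if - 2 * int (r mod 2 ^ k) - 1 \<le> p \<and> p \<le> 2 ^ n - 1 then c r + c' r else 0)"
          using *(1)[unfolded Q_def, THEN spec[of _ r], THEN spec[of _ p]]
            *(2)[unfolded Q_def, THEN spec[of _ r], THEN spec[of _ p]]
          by (cases "a r p = 0"; cases "b r p = 0") (auto split: if_splits)
      qed
      then show "v + w \<in> {v. \<exists>a b c. Q v a b c}" by blast
    next
      fix x :: real and v assume "v \<in> {v. \<exists>a b c. Q v a b c}"
      then obtain a b c where *: "Q v a b c" by blast
      then have "Q (x *\<^sub>R v) (\<lambda>r p. x * a r p) (\<lambda>r p. x * b r p) (\<lambda>r. x * c r)"
        unfolding Q_def by (auto simp: scaleR_fun_def distrib_left right_diff_distrib)
      then show "x *\<^sub>R v \<in> {v. \<exists>a b c. Q v a b c}" by blast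
    qed
  qed
  then obtain a b c where "Q v a b c" using assms(2) by blast
  then show thesis unfolding Q_def by (intro that[of a b c]) blast+
qed

text \<open>Subtracting the two expansions of \<open>v\<close> gives a solution of the homogeneous
  path system, so the coefficients agree. Since X and Y use disjoint ranges of \<open>p\<close>,
  they all vanish.\<close>

lemma span_Xset_Int_span_Yset:
  assumes "k < n" "v \<in> span (Xset n (Suc k))" "v \<in> span (Yset n (Suc k))"
  shows "v = 0"
proof -
  obtain f where f: "f \<in> Gspace n k" "v = adrt_step n k f"
    using assms(2) unfolding adrt_step_image_Gspace[OF assms(1), symmetric] by blast
  obtain a b c where Y:
    "\<And>r p. a r p \<noteq> 0 \<Longrightarrow> - 2 * int (r mod 2 ^ k) \<le> p \<and> p \<le> - int (r mod 2 ^ k) - 1"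
    "\<And>r p. b r p \<noteq> 0 \<Longrightarrow> 2 ^ n - int (r mod 2 ^ k) \<le> p \<and> p \<le> 2 ^ n - 1"
    "\<And>r p. v (p, 2 * r) =
      a r p + b r p + (if - 2 * int (r mod 2 ^ k) \<le> p \<and> p \<le> 2 ^ n - 1 then c r else 0)"
    "\<And>r p. v (p, Suc (2 * r)) =
      a r p + b r (p + 1) - (if - 2 * int (r mod 2 ^ k) - 1 \<le> p \<and> p \<le> 2 ^ n - 1 then c r else 0)"
    using span_Yset_coefficients[OF assms(1,3)] by metis
  have "v (p, 2 * r) = 0 \<and> v (p, Suc (2 * r)) = 0" for p r
  proof (cases "2 * r < 2 ^ n")
    case False
    then show ?thesis
      using row_pair_less[OF assms(1), of r] by (simp add: f(2) adrt_step_rows)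
  next
    case True
    let ?q = "int (r mod 2 ^ k)"
    define a' where "a' p = f (p, top_row k r)" for p
    \<comment> \<open>The shift by \<open>?q\<close> makes this the coefficient of
      \<open>psi\<close> with index \<open>p\<close>, as in \<open>adrt_step_delta\<close>.\<close>
    define b' where "b' p = f (p + ?q, bot_row k r)" for p
    have q: "?q < 2 ^ n"
      using True by (intro int_mod_less_pow) simp
    have X: "v (p, 2 * r) = a' p + b' p" "v (p, Suc (2 * r)) = a' p + b' (p + 1)" for p
      using True row_pair_less[OF assms(1), of r]
      by (simp_all add: f(2) adrt_step_rows a'_def b'_def add_ac)
    have supp: "a' p \<noteq> 0 \<Longrightarrow> - ?q \<le> p \<and> p \<le> 2 ^ n - 1"
      "b' p \<noteq> 0 \<Longrightarrow> - 2 * ?q \<le> p \<and> p \<le> 2 ^ n - ?q - 1" for p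
      using f(1) assms(1) unfolding a'_def b'_def by (fastforce simp: Gspace_iff)+
    have "- 2 * ?q \<le> 2 ^ n - 1" using q by linarith
    moreover have "b r j - b' j = 0" if "\<not> (- 2 * ?q \<le> j \<and> j \<le> 2 ^ n - 1)" for j
    proof -
      have "b r j = 0" using Y(2)[of r j] that q by linarith
      moreover have "b' j = 0" using supp(2)[of j] that q by linarith
      ultimately show ?thesis by simp
    qed
    moreover have "(a r j - a' j) + (b r j - b' j) +
        (if - 2 * ?q \<le> j \<and> j \<le> 2 ^ n - 1 then c r else 0) = 0" for j
      using X(1)[of j] Y(3)[of j r] by linarith
    moreover have "(a r j - a' j) + (b r (j + 1) - b' (j + 1)) -
        (if - 2 * ?q - 1 \<le> j \<and> j \<le> 2 ^ n - 1 then c r else 0) = 0" for j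
      using X(2)[of j] Y(4)[of j r] by linarith
    ultimately have "a r p - a' p = 0" "b r p - b' p = 0" for p
      by (fact path_coefficients_unique)+
    then have eq: "a r p = a' p" "b r p = b' p" for p by simp_all
    have "a' p = 0" "b' p = 0" for p
      using supp[of p] Y(1,2)[of r p] unfolding eq by linarith+
    then show ?thesis by (simp add: X)
  qed
  then show ?thesis by (intro image_eq_rowsI) simp_all
qed

section \<open>X and Y together span G_m\<close>

text \<open>Jointly X and Y contain every \<open>phi\<close> and \<open>psi\<close> with
  \<open>- 2 * q \<le> p < 2 ^ n\<close>. For \<open>N = 2 ^ n + 2 * q\<close> these are the
  \<open>2 * N\<close> edges of a path with \<open>2 * N + 1\<close> pixels, and \<open>mu\<close>
  supplies the missing dimension.\<close>

lemma delta_in_span: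
  assumes "k < n" "2 * r < 2 ^ n"
  defines "q \<equiv> int (r mod 2 ^ k)"
  shows "- 2 * q \<le> p \<Longrightarrow> p < 2 ^ n \<Longrightarrow> delta p (2 * r) \<in> span (Xset n (Suc k) \<union> Yset n (Suc k))"
    and "- 2 * q - 1 \<le> p \<Longrightarrow> p < 2 ^ n \<Longrightarrow>
      delta p (Suc (2 * r)) \<in> span (Xset n (Suc k) \<union> Yset n (Suc k))"
proof -
  let ?W = "span (Xset n (Suc k) \<union> Yset n (Suc k))"
  have phi: "delta p (2 * r) + delta p (Suc (2 * r)) \<in> ?W" if "- 2 * q \<le> p" "p < 2 ^ n" for p
  proof (rule span_base)
    from that consider "- q \<le> p" "p \<le> 2 ^ n - 1" | "- 2 * q \<le> p" "p \<le> - q - 1" by linarith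
    then show "delta p (2 * r) + delta p (Suc (2 * r)) \<in> Xset n (Suc k) \<union> Yset n (Suc k)"
      unfolding Xset_rows[OF assms(1)] Yset_rows[OF assms(1)] q_def
      using assms(2) by cases blast+
  qed
  have psi: "delta p (2 * r) + delta (p - 1) (Suc (2 * r)) \<in> ?W" if "- 2 * q \<le> p" "p < 2 ^ n" for p
  proof (rule span_base)
    from that consider "- 2 * q \<le> p" "p \<le> 2 ^ n - q - 1" | "2 ^ n - q \<le> p" "p \<le> 2 ^ n - 1" by linarith
    then show "delta p (2 * r) + delta (p - 1) (Suc (2 * r)) \<in> Xset n (Suc k) \<union> Yset n (Suc k)"
      unfolding Xset_rows[OF assms(1)] Yset_rows[OF assms(1)] q_def
      using assms(2) by cases blast+
  qed
  define a where "a = delta (- 2 * q) (2 * r)"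
  txt \<open>Along the path all pixels agree with \<open>a\<close> up to sign modulo the span, so \<open>\<mu>\<close> is congruent to a
    positive multiple of \<open>a\<close>.\<close>
  have even: "delta p (2 * r) - a \<in> ?W" if "- 2 * q \<le> p" "p < 2 ^ n" for p
    using that
  proof (induction p rule: int_ge_induct)
    case base
    show ?case unfolding a_def by (simp only: diff_self span_zero)
  next
    case (step i)
    have "delta (i + 1) (2 * r) - a = (delta i (2 * r) - a) -
        (delta i (2 * r) + delta i (Suc (2 * r))) +
        (delta (i + 1) (2 * r) + delta (i + 1 - 1) (Suc (2 * r)))"
      by simp
    also have "\<dots> \<in> ?W"
      by (intro span_add span_diff step.IH phi psi) (use step in auto)
    finally show ?case .
  qed
  have odd: "delta p (Suc (2 * r)) + a \<in> ?W" if "- 2 * q - 1 \<le> p" "p < 2 ^ n" for p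
  proof (cases "- 2 * q \<le> p")
    case True
    have "delta p (Suc (2 * r)) + a =
        (delta p (2 * r) + delta p (Suc (2 * r))) - (delta p (2 * r) - a)" by simp
    also have "\<dots> \<in> ?W" by (intro span_diff phi even) (use that True in auto)
    finally show ?thesis .
  next
    case False
    \<comment> \<open>This is the end of the path, joined to \<open>a\<close> by the edge
      \<open>psi\<close> with index \<open>- 2 * q\<close>.\<close>
    then have "p = - 2 * q - 1" using that by simp
    moreover have "q \<ge> 0" by (simp add: q_def)
    then have "- 2 * q < 2 ^ n" by (smt (verit) zero_less_power)
    ultimately show ?thesis using psi[of "- 2 * q"] by (simp add: a_def add.commute)
  qed
  let ?E = "{- 2 * q..2 ^ n - 1}" and ?O = "{- 2 * q - 1..2 ^ n - 1}"
  have mu: "(\<Sum>p\<in>?E. delta p (2 * r)) - (\<Sum>p\<in>?O. delta p (Suc (2 * r))) \<in> ?W"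
    by (rule span_base) (use assms(2) in \<open>auto simp: Yset_rows[OF assms(1)] q_def\<close>)
  \<comment> \<open>The minus sign in \<open>mu\<close> meets the change of sign between the rows,
    so the two cardinalities add up instead of cancelling.\<close>
  have "(\<Sum>p\<in>?E. delta p (2 * r)) - (\<Sum>p\<in>?O. delta p (Suc (2 * r))) -
      (\<Sum>p\<in>?E. delta p (2 * r) - a) + (\<Sum>p\<in>?O. delta p (Suc (2 * r)) + a) =
      (\<Sum>p\<in>?E. a) + (\<Sum>p\<in>?O. a)"
    by (simp only: sum_subtractf sum.distrib algebra_simps)
  also have "\<dots> = (real (card ?E) + real (card ?O)) *\<^sub>R a"
    by (simp only: sum_constant_scaleR scaleR_add_left)
  finally have scaled: "(real (card ?E) + real (card ?O)) *\<^sub>R a \<in> ?W"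
    using span_add[OF span_diff[OF mu span_sum[of ?E "\<lambda>p. delta p (2 * r) - a"]]
      span_sum[of ?O "\<lambda>p. delta p (Suc (2 * r)) + a"]] even odd by simp
  define w where "w = real (card ?E) + real (card ?O)"
  have "0 < real (card ?O)"
    by (simp add: q_def add_nonneg_pos)
  then have "w \<noteq> 0" unfolding w_def by (metis add_nonneg_pos of_nat_0_le_iff less_irrefl)
  then have "a = (1 / w) *\<^sub>R (w *\<^sub>R a)" by simp
  also have "\<dots> \<in> ?W" by (rule span_scale) (use scaled in \<open>simp only: w_def\<close>)
  finally have a: "a \<in> ?W" .
  show "delta p (2 * r) \<in> ?W" if "- 2 * q \<le> p" "p < 2 ^ n"
    using span_add[OF even[OF that] a] by simp
  show "delta p (Suc (2 * r)) \<in> ?W" if "- 2 * q - 1 \<le> p" "p < 2 ^ n"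
    using span_diff[OF odd[OF that] a] by simp
qed

lemma Gspace_subset_span:
  assumes "k < n" shows "Gspace n (Suc k) \<subseteq> span (Xset n (Suc k) \<union> Yset n (Suc k))"
proof -
  have "delta h s \<in> span (Xset n (Suc k) \<union> Yset n (Suc k))"
    if s: "s < 2 ^ n" "- int (s mod 2 ^ Suc k) \<le> h" "h < 2 ^ n" for h s
  proof (cases "even s")
    case True
    then obtain r where r: "s = 2 * r" by blast
    show ?thesis
      using s delta_in_span(1)[OF assms, of r h] unfolding r even_row_mod by simp
  next
    case False
    then obtain r where r: "s = Suc (2 * r)" by (metis oddE Suc_eq_plus1)
    show ?thesis
      using s delta_in_span(2)[OF assms, of r h] unfolding r odd_row_mod by simp
  qed
  then show ?thesis
    unfolding Gspace_eq_span[OF Suc_leI[OF assms]] by (intro span_minimal) auto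
qed

section \<open>The range in terms of span X\<close>

text \<open>Spanning gives a witness for the definite description in
  \<open>projection_along\<close>, and the trivial intersection makes it unique.\<close>

lemma Pmap_eq_0_iff:
  assumes "k < n" "g \<in> Gspace n (Suc k)"
  shows "Pmap n (Suc k) g = 0 \<longleftrightarrow> g \<in> span (Xset n (Suc k))"
proof -
  let ?X = "span (Xset n (Suc k))" and ?Y = "span (Yset n (Suc k))"
  obtain x y where xy: "x \<in> ?X" "y \<in> ?Y" "g = x + y"
    using Gspace_subset_span[OF assms(1)] assms(2) unfolding span_Un by blast
  have "Pmap n (Suc k) g = y"
    unfolding Pmap_def projection_along_def
  proof (rule the_equality)
    show "y \<in> ?Y \<and> g - y \<in> ?X" using xy by simp
  next
    fix z assume z: "z \<in> ?Y \<and> g - z \<in> ?X"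
    then have "z - y \<in> ?Y" using xy span_diff by blast
    moreover have "x - (g - z) \<in> ?X" using xy z span_diff by blast
    then have "z - y \<in> ?X" using xy(3) by simp
    ultimately have "z - y = 0" using span_Xset_Int_span_Yset[OF assms(1)] by blast
    then show "z = y" by simp
  qed
  moreover have "g \<in> ?X \<longleftrightarrow> y = 0"
  proof
    assume "g \<in> ?X"
    then have "g - x \<in> ?X" using xy(1) span_diff by blast
    then show "y = 0" using xy span_Xset_Int_span_Yset[OF assms(1)] by simp
  qed (use xy in simp)
  ultimately show ?thesis by simp
qed

text \<open>Lying in \<open>span (Xset n (Suc k))\<close> forces the support condition, so both
  clauses at level \<open>Suc k\<close> merge into one.\<close>

lemma adrt_range_iff:
  "g \<in> adrt_range n \<longleftrightarrow> g \<in> Gspace n n \<and> (\<forall>k<n. Tmap n (Suc k) g \<in> span (Xset n (Suc k)))"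
proof -
  have "Tmap n (Suc k) g \<in> Gspace n (Suc k) \<and> Pmap n (Suc k) (Tmap n (Suc k) g) = 0 \<longleftrightarrow>
      Tmap n (Suc k) g \<in> span (Xset n (Suc k))" if "k < n" for k
    using Pmap_eq_0_iff[OF that] Xset_subset_Gspace[OF that] by blast
  then show ?thesis
    unfolding adrt_range_def image_Suc_lessThan [symmetric] mem_Collect_eq ball_simps lessThan_iff
    by blast
qed

section \<open>The two compositions are identities\<close>

lemma adrt_upto_in_Gspace:
  assumes "f \<in> Gspace n 0" "k \<le> n" shows "adrt_upto n k f \<in> Gspace n k"
  using assms(2)
proof (induction k)
  case (Suc k)
  then have "adrt_upto n (Suc k) f \<in> span (Xset n (Suc k))"
    by (simp flip: adrt_step_image_Gspace)
  then show ?case using Xset_subset_Gspace Suc.prems by (metis Suc_le_eq subsetD)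
qed (use assms in simp)

text \<open>Downward induction from \<open>n\<close>: each partial inverse strips off the last
  remaining step.\<close>

lemma Tmap_adrt_upto:
  assumes "f \<in> Gspace n 0" "k \<le> n" shows "Tmap n k (adrt_upto n n f) = adrt_upto n k f"
  using assms(2)
proof (induction k rule: inc_induct)
  case base
  then show ?case by (simp add: Tmap_def)
next
  case (step k)
  then show ?case
    using adrt_upto_in_Gspace[OF assms(1), of k] by (simp add: Tmap_Suc Sinv_adrt_step)
qed

text \<open>The range condition provides some preimage under the step, and the left inverse
  identifies it as \<open>Tmap n k g\<close>. On such images the partial inverse is thus a right
  inverse as well.\<close>

lemma adrt_step_Tmap:
  assumes "g \<in> adrt_range n" "k < n"
  shows "Tmap n k g \<in> Gspace n k" "adrt_step n k (Tmap n k g) = Tmap n (Suc k) g"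
proof -
  have "Tmap n (Suc k) g \<in> adrt_step n k ` Gspace n k"
    using assms by (simp add: adrt_range_iff adrt_step_image_Gspace)
  then obtain f where f: "f \<in> Gspace n k" "Tmap n (Suc k) g = adrt_step n k f" by blast
  then have "Tmap n k g = f" using assms(2) by (simp add: Tmap_Suc Sinv_adrt_step)
  then show "Tmap n k g \<in> Gspace n k" "adrt_step n k (Tmap n k g) = Tmap n (Suc k) g"
    using f by simp_all
qed

lemma adrt_upto_Tmap:
  assumes "g \<in> adrt_range n" "k \<le> n" shows "adrt_upto n k (Tmap n 0 g) = Tmap n k g"
  using assms(2) by (induction k) (simp_all add: adrt_step_Tmap[OF assms(1)])

theorem theorem3p10:
  fixes n :: nat
  shows "bij_betw (adrt n) (square_images n) (adrt_range n)"
proof (rule bij_betw_byWitness[where f' = "Tmap n 0"])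
  have sq: "f \<in> Gspace n 0" "adrt n f = adrt_upto n n f" if "f \<in> square_images n" for f
    using that adrt_eq_adrt_upto by (auto simp: square_images_eq_Gspace Gspace_def)
  have "Tmap n n g = g" for g by (simp add: Tmap_def)
  \<comment> \<open>For \<open>n = 0\<close> there is no step: \<open>Tmap n 0\<close> is the
    identity and the range is \<open>Gspace 0 0\<close>.\<close>
  have T0: "Tmap n 0 g \<in> square_images n" if "g \<in> adrt_range n" for g
  proof (cases n)
    case 0
    then show ?thesis using that by (simp add: adrt_range_def Tmap_def square_images_eq_Gspace)
  qed (use adrt_step_Tmap(1)[OF that, of 0] in \<open>simp add: square_images_eq_Gspace\<close>)
  then show "Tmap n 0 ` adrt_range n \<subseteq> square_images n" by blast
  show "\<forall>f\<in>square_images n. Tmap n 0 (adrt n f) = f"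
    using sq Tmap_adrt_upto[of _ n 0] by simp
  show "\<forall>g\<in>adrt_range n. adrt n (Tmap n 0 g) = g"
    using sq(2) T0 adrt_upto_Tmap[of _ n n] \<open>Tmap n n _ = _\<close> by simp
  \<comment> \<open>By \<open>Tmap_adrt_upto\<close> these are the images that the range condition
    tests, and each is the result of a step.\<close>
  have "adrt_upto n (Suc k) f \<in> span (Xset n (Suc k))" if "f \<in> Gspace n 0" "k < n" for f k
    using adrt_upto_in_Gspace[OF that(1), of k] that(2) by (simp flip: adrt_step_image_Gspace)
  then show "adrt n ` square_images n \<subseteq> adrt_range n"
    using sq adrt_upto_in_Gspace[of _ n n] Tmap_adrt_upto[of _ n]
    by (auto simp: adrt_range_iff simp del: adrt_upto.simps)
qed

end
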